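(* Let $E$ be a topological vector space. If $E$ has a Markushevich basis $(x_i,x_i^* )_{i\in I}$ whose index set satisfies $\operatorname{card}(I)>\aleph_0$, then $E$ does not satisfy $(C_0)$.
   Context: Topological vector spaces (TVS) are over $\mathbb{C}$ and are assumed Hausdorff and complete. $E^*$ denotes the dual of $E$ (the space of continuous linear functionals on $E$). A family of pairs $x_i\in E$, $x_i^*\in E^*$ ($i\in I$) is a Markushevich basis (M-basis) of $E$ if: (a) Biorthogonality: $x_i^*(x_j)=\delta_{i,j}$ for all $i,j\in I$; (b) Completeness: $E=\overline{\mathrm{span}}\{x_i: i\in I\}$; (c) Totality: $\bigcap_{i\in I}\ker(x_i^* )=\{0\}$. A TVS $E$ satisfies $(C_0)$ (the countable intersection property for subspaces) if whenever $(M_i)_{i\in I}$ is a family of closed linear subspaces of $E$ with $\bigcap_{i\in I} M_i=\{0\}$, there is a countable set of indices $I_0\subset I$ such that $\bigcap_{i\in I_0} M_i=\{0\}$. *)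

theory Defs
  imports "HOL-Analysis.Analysis"
begin

(* Hausdorff complete topological vector spaces over the complex numbers. The type classes give
   the additive group, its Hausdorff topology and completeness in the sense of Cauchy filters.
   The uniformity is no extra structure: by uniform_topological_group_add it is the
   translation-invariant one determined by the neighbourhoods of 0. *)
locale complex_tvs = vector_space scale
  for scale :: "complex \<Rightarrow>
      'a::{uniform_topological_group_add, topological_ab_group_add, complete_uniform_space, t2_space}
      \<Rightarrow> 'a" +
  assumes continuous_scale: "continuous_on UNIV (\<lambda>(c, x). scale c x)"
begin

definition dual :: "('a \<Rightarrow> complex) set" where
  "dual = {f. Vector_Spaces.linear scale (*) f \<and> continuous_on UNIV f}"

definition M_basis :: "'i set \<Rightarrow> ('i \<Rightarrow> 'a) \<Rightarrow> ('i \<Rightarrow> 'a \<Rightarrow> complex) \<Rightarrow> bool" where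
  "M_basis I x x' \<longleftrightarrow>
     (\<forall>i\<in>I. x' i \<in> dual) \<and>
     (\<forall>i\<in>I. \<forall>j\<in>I. x' i (x j) = (if i = j then 1 else 0)) \<and>
     closure (span (x ` I)) = UNIV \<and>
     (\<Inter>i\<in>I. {v. x' i v = 0}) = {0}"

(* A definition cannot quantify over all types of indices. Indexing by subsets of E loses nothing,
   since a family of subspaces may be indexed by its own members: see C0_family. *)
definition C0 :: bool where
  "C0 \<longleftrightarrow>
     (\<forall>(I :: 'a set set) M.
        (\<forall>i\<in>I. subspace (M i) \<and> closed (M i)) \<and> (\<Inter>i\<in>I. M i) = {0} \<longrightarrow>
        (\<exists>I0\<subseteq>I. countable I0 \<and> (\<Inter>i\<in>I0. M i) = {0}))"

lemma C0_family:
  fixes I :: "'i set" and M :: "'i \<Rightarrow> 'a set"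
  assumes "C0" and "\<And>i. i \<in> I \<Longrightarrow> subspace (M i)" and "\<And>i. i \<in> I \<Longrightarrow> closed (M i)"
    and "(\<Inter>i\<in>I. M i) = {0}"
  shows "\<exists>I0\<subseteq>I. countable I0 \<and> (\<Inter>i\<in>I0. M i) = {0}"
proof -
  have "\<exists>J\<subseteq>M ` I. countable J \<and> (\<Inter>N\<in>J. N) = {0}"
    using assms(1)[unfolded C0_def, rule_format, of "M ` I" "\<lambda>N. N"] assms(2-4) by auto
  then obtain J where J: "J \<subseteq> M ` I" "countable J" "(\<Inter>N\<in>J. N) = {0}"
    by blast
  then obtain I0 where "countable I0" "I0 \<subseteq> I" "J = M ` I0"
    using countable_subset_image[of J M I] by blast
  with J(3) show ?thesis
    by auto
qed

end

end

theory Submission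
  imports Defs
begin

text \<open>
  By totality the kernels of the coordinate functionals are closed subspaces with trivial
  intersection. If countably many of them already met in zero, then, the index set being
  uncountable, some basis vector would be left out of that countable choice; by biorthogonality it
  lies in all the chosen kernels, so it would be zero, although its own coordinate is one.
\<close>

lemma (in complex_tvs) subspace_kernel_dual:
  assumes "f \<in> dual"
  shows "subspace {v. f v = 0}"
proof -
  interpret f: Vector_Spaces.linear scale "(*)" f
    using assms by (simp add: dual_def)
  show ?thesis
    by (rule f.subspace_kernel)
qed

lemma (in complex_tvs) closed_kernel_dual:
  assumes "f \<in> dual"
  shows "closed {v. f v = 0}"
proof -
  have "continuous_on UNIV f"
    using assms by (simp add: dual_def)
  then show ?thesis
    by (rule closed_Collect_eq[OF _ continuous_on_const])
qed

theorem proposition2p4: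
  fixes scale :: "complex \<Rightarrow>
      'a::{uniform_topological_group_add, topological_ab_group_add, complete_uniform_space, t2_space}
      \<Rightarrow> 'a"
    and I :: "'i set" and x :: "'i \<Rightarrow> 'a" and x' :: "'i \<Rightarrow> 'a \<Rightarrow> complex"
  assumes "complex_tvs scale"
    and "complex_tvs.M_basis scale I x x'"
    and "uncountable I"
  shows "\<not> complex_tvs.C0 scale"
proof
  interpret complex_tvs scale
    by fact
  let ?K = "\<lambda>i. {v. x' i v = 0}"
  assume "C0"
  have dual: "x' i \<in> dual" if "i \<in> I" for i
    using assms(2) that by (simp add: M_basis_def)
  have biorth: "x' i (x j) = (if i = j then 1 else 0)" if "i \<in> I" "j \<in> I" for i j
    using assms(2) that by (simp add: M_basis_def)
  have total: "(\<Inter>i\<in>I. ?K i) = {0}"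
    using assms(2) by (simp add: M_basis_def)
  obtain I0 where I0: "I0 \<subseteq> I" "countable I0" "(\<Inter>i\<in>I0. ?K i) = {0}"
    using C0_family[OF \<open>C0\<close> subspace_kernel_dual[OF dual] closed_kernel_dual[OF dual] total]
    by metis
  obtain j where j: "j \<in> I" "j \<notin> I0"
    using I0(2) assms(3) countable_subset[of I I0] by (meson subsetI)
  have "x j \<in> (\<Inter>i\<in>I0. ?K i)"
    using I0(1) j by (auto simp: biorth subset_iff)
  then have "x j = 0"
    unfolding I0(3) by simp
  moreover have "x' j 0 = 0"
  proof -
    have "0 \<in> (\<Inter>i\<in>I. ?K i)"
      unfolding total by simp
    then show ?thesis
      using j(1) by simp
  qed
  ultimately show False
    using biorth[OF j(1) j(1)] by simp
qed

end
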